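(* Let $p$ be an odd prime. There is an induced copy of the Rado graph $\mathcal{R}$ in $\tilde{\Gamma}(H_\omega(p))$.
   Context: $H_\omega(p)$ (also written $H_\infty(p)$) is the countably infinite Heisenberg group: the set of $[x,y,z]$ with $z\in\mathbb{F}_p$ and $x,y$ infinite sequences $(x_1,x_2,\dots)$, $(y_1,y_2,\dots)$ of elements of $\mathbb{F}_p$ with at most finitely many nonzero entries, with product $[x,y,z][x',y',z'] = [x+x', y+y', z+z'+x\cdot y']$, where $x\cdot y' = \sum_i x_iy'_i$. $\tilde{\Gamma}(H_\omega(p))$ is the graph whose vertices are the non-central conjugacy classes $C_{x,y}=\{[x,y,z]: z\in\mathbb{F}_p\}$, $(x,y)\neq(0,0)$, with an edge between $C_{x,y}$ and $C_{a,b}$ if and only if their elements commute, i.e. $x\cdot b - a\cdot y = 0$. Loops are ignored: an induced copy of a graph $R$ is given by an injective map $f$ from the vertices of $R$ to vertices of $\tilde\Gamma$ such that for distinct $u,v$, $u$ and $v$ are adjacent in $R$ if and only if $f(u)$ and $f(v)$ are adjacent in $\tilde\Gamma$. The Rado (random) graph $\mathcal{R}$ is the unique (up to isomorphism) countably infinite graph such that for any two disjoint finite sets $U,W$ of vertices there is a vertex outside $U\cup W$ adjacent to all of $U$ and to none of $W$. *)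

theory Defs
  imports "HOL-Number_Theory.Residues" "HOL-Algebra.Group_Action" "HOL-Library.Countable_Set" "HOL-Library.Nat_Bijection"
begin

section \<open>The Heisenberg group of countably infinite rank\<close>

type_synonym heis = "(nat \<Rightarrow> int) \<times> (nat \<Rightarrow> int) \<times> int"

abbreviation Fp :: "nat \<Rightarrow> int ring" where
  "Fp p \<equiv> residue_ring (int p)"

text \<open>Sequences are indexed from 0; all entries are the representatives \<open>0, \<dots>, p - 1\<close>.\<close>

definition fin_seqs :: "nat \<Rightarrow> (nat \<Rightarrow> int) set" where
  "fin_seqs p = {x. (\<forall>i. x i \<in> carrier (Fp p)) \<and> finite {i. x i \<noteq> \<zero>\<^bsub>Fp p\<^esub>}}"

definition seq_add :: "nat \<Rightarrow> (nat \<Rightarrow> int) \<Rightarrow> (nat \<Rightarrow> int) \<Rightarrow> nat \<Rightarrow> int" where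
  "seq_add p x y = (\<lambda>i. x i \<oplus>\<^bsub>Fp p\<^esub> y i)"

definition dot :: "nat \<Rightarrow> (nat \<Rightarrow> int) \<Rightarrow> (nat \<Rightarrow> int) \<Rightarrow> int" where
  "dot p x y =
     (\<Oplus>\<^bsub>Fp p\<^esub>i\<in>{i. x i \<otimes>\<^bsub>Fp p\<^esub> y i \<noteq> \<zero>\<^bsub>Fp p\<^esub>}. x i \<otimes>\<^bsub>Fp p\<^esub> y i)"

definition heisenberg :: "nat \<Rightarrow> heis monoid" where
  "heisenberg p =
     \<lparr>carrier = fin_seqs p \<times> fin_seqs p \<times> carrier (Fp p),
      monoid.mult = (\<lambda>(x, y, z) (x', y', z').
        (seq_add p x x', seq_add p y y', (z \<oplus>\<^bsub>Fp p\<^esub> z') \<oplus>\<^bsub>Fp p\<^esub> dot p x y')),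
      one = (\<lambda>_. \<zero>\<^bsub>Fp p\<^esub>, \<lambda>_. \<zero>\<^bsub>Fp p\<^esub>, \<zero>\<^bsub>Fp p\<^esub>)\<rparr>"


section \<open>The graph on the non-central conjugacy classes\<close>

definition center :: "('a, 'b) monoid_scheme \<Rightarrow> 'a set" where
  "center G = {z \<in> carrier G. \<forall>g\<in>carrier G. g \<otimes>\<^bsub>G\<^esub> z = z \<otimes>\<^bsub>G\<^esub> g}"

definition conj_class :: "('a, 'b) monoid_scheme \<Rightarrow> 'a \<Rightarrow> 'a set" where
  "conj_class G = orbit G (\<lambda>g. \<lambda>h \<in> carrier G. g \<otimes>\<^bsub>G\<^esub> h \<otimes>\<^bsub>G\<^esub> inv\<^bsub>G\<^esub> g)"

definition noncentral_classes :: "('a, 'b) monoid_scheme \<Rightarrow> 'a set set" where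
  "noncentral_classes G = conj_class G ` (carrier G - center G)"

text \<open>Every class in the graph of the Heisenberg group is adjacent to itself; these loops
  are disregarded by \<open>induced_copy\<close> below.\<close>

definition commuting_classes :: "('a, 'b) monoid_scheme \<Rightarrow> 'a set \<Rightarrow> 'a set \<Rightarrow> bool" where
  "commuting_classes G A B \<longleftrightarrow> (\<forall>a\<in>A. \<forall>b\<in>B. a \<otimes>\<^bsub>G\<^esub> b = b \<otimes>\<^bsub>G\<^esub> a)"


section \<open>The Rado graph\<close>

text \<open>A graph is given by its vertex set and its adjacency relation.\<close>

definition simple_graph :: "'v set \<Rightarrow> ('v \<Rightarrow> 'v \<Rightarrow> bool) \<Rightarrow> bool" where
  "simple_graph V adj \<longleftrightarrow>
     (\<forall>u\<in>V. \<forall>v\<in>V. adj u v \<longrightarrow> adj v u) \<and> (\<forall>v\<in>V. \<not> adj v v)"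

definition rado_graph :: "'v set \<Rightarrow> ('v \<Rightarrow> 'v \<Rightarrow> bool) \<Rightarrow> bool" where
  "rado_graph V adj \<longleftrightarrow>
     simple_graph V adj \<and> countable V \<and> infinite V \<and>
     (\<forall>U W. finite U \<and> finite W \<and> U \<subseteq> V \<and> W \<subseteq> V \<and> U \<inter> W = {} \<longrightarrow>
        (\<exists>v \<in> V - (U \<union> W). (\<forall>u\<in>U. adj v u) \<and> (\<forall>w\<in>W. \<not> adj v w)))"

definition induced_copy ::
    "'v set \<Rightarrow> ('v \<Rightarrow> 'v \<Rightarrow> bool) \<Rightarrow> 'w set \<Rightarrow> ('w \<Rightarrow> 'w \<Rightarrow> bool) \<Rightarrow> bool" where
  "induced_copy V adj V' adj' \<longleftrightarrow>
     (\<exists>f. inj_on f V \<and> f ` V \<subseteq> V' \<and>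
        (\<forall>u\<in>V. \<forall>v\<in>V. u \<noteq> v \<longrightarrow> (adj u v \<longleftrightarrow> adj' (f u) (f v))))"


section \<open>Consistency of the definitions\<close>

lemma carrier_Fp: "carrier (Fp p) = {0..int p - 1}"
  and zero_Fp: "\<zero>\<^bsub>Fp p\<^esub> = 0"
  and add_Fp: "a \<oplus>\<^bsub>Fp p\<^esub> b = (a + b) mod int p"
  and mult_Fp: "a \<otimes>\<^bsub>Fp p\<^esub> b = (a * b) mod int p"
  by (simp_all add: residue_ring_def)

lemma fin_seqs_iff: "x \<in> fin_seqs p \<longleftrightarrow> (\<forall>i. 0 \<le> x i \<and> x i < int p) \<and> finite {i. x i \<noteq> 0}"
  by (auto simp: fin_seqs_def carrier_Fp zero_Fp)

lemma finsum_Fp: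
  assumes "p > 1" "finite S" "\<And>i. i \<in> S \<Longrightarrow> f i \<in> carrier (Fp p)"
  shows "finsum (Fp p) f S = (\<Sum>i\<in>S. f i) mod int p"
proof -
  interpret residues "int p" "Fp p"
    using assms(1) by unfold_locales auto
  show ?thesis
    using assms(2,3)
  proof (induction S rule: finite_induct)
    case empty
    then show ?case by (simp add: zero_Fp)
  next
    case (insert a S)
    then show ?case
      using finsum_insert[of S a f] by (auto simp: add_Fp mod_simps)
  qed
qed

lemma dot_eq:
  assumes "p > 1" "finite S" "\<And>i. i \<notin> S \<Longrightarrow> x i * y i = 0"
  shows "dot p x y = (\<Sum>i\<in>S. x i * y i) mod int p"
proof -
  let ?T = "{i. (x i * y i) mod int p \<noteq> 0}"
  have TS: "?T \<subseteq> S"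
    using assms(3) by (metis (mono_tags, lifting) mem_Collect_eq mod_0 subsetI)
  then have "finite ?T"
    using assms(2) finite_subset by blast
  then have "dot p x y = (\<Sum>i\<in>?T. (x i * y i) mod int p) mod int p"
    using assms(1) unfolding dot_def mult_Fp zero_Fp
    by (subst finsum_Fp) (auto simp: carrier_Fp)
  also have "(\<Sum>i\<in>?T. (x i * y i) mod int p) = (\<Sum>i\<in>S. (x i * y i) mod int p)"
    using TS assms(2) by (intro sum.mono_neutral_left) auto
  finally show ?thesis
    by (simp add: mod_sum_eq)
qed

lemma fin_seqs_add: "p > 1 \<Longrightarrow> x \<in> fin_seqs p \<Longrightarrow> y \<in> fin_seqs p \<Longrightarrow> seq_add p x y \<in> fin_seqs p"
  unfolding fin_seqs_iff seq_add_def add_Fp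
  by (auto intro: finite_subset[of _ "{i. x i \<noteq> 0} \<union> {i. y i \<noteq> 0}"])

lemma dot_range: "p > 1 \<Longrightarrow> x \<in> fin_seqs p \<Longrightarrow> 0 \<le> dot p x y \<and> dot p x y < int p"
  by (subst (1 2) dot_eq[of p "{i. x i \<noteq> 0}"]) (auto simp: fin_seqs_iff)

lemma dot_add_left:
  assumes "p > 1" "x \<in> fin_seqs p" "x' \<in> fin_seqs p"
  shows "dot p (seq_add p x x') y = (dot p x y + dot p x' y) mod int p"
proof -
  let ?S = "{i. x i \<noteq> 0} \<union> {i. x' i \<noteq> 0}"
  have *: "finite ?S" using assms by (auto simp: fin_seqs_iff)
  have "dot p (seq_add p x x') y = (\<Sum>i\<in>?S. ((x i + x' i) mod int p) * y i) mod int p"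
    using assms(1) * by (subst dot_eq[of p ?S]) (auto simp: seq_add_def add_Fp)
  also have "\<dots> = (\<Sum>i\<in>?S. (x i + x' i) * y i) mod int p"
    by (subst (1 2) mod_sum_eq[symmetric]) (simp add: mod_simps)
  also have "\<dots> = (dot p x y + dot p x' y) mod int p"
    using assms(1) * by (subst (1 2) dot_eq[of p ?S])
      (auto simp: mod_simps distrib_right sum.distrib)
  finally show ?thesis .
qed

lemma dot_commute: "dot p x y = dot p y x"
  by (simp add: dot_def mult_Fp mult.commute)

lemma dot_add_right:
  assumes "p > 1" "y \<in> fin_seqs p" "y' \<in> fin_seqs p"
  shows "dot p x (seq_add p y y') = (dot p x y + dot p x y') mod int p"
  using dot_add_left[OF assms, of x] by (simp add: dot_commute)

lemma dot_zero [simp]: "p > 1 \<Longrightarrow> dot p (\<lambda>_. 0) y = 0" "p > 1 \<Longrightarrow> dot p y (\<lambda>_. 0) = 0"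
  by (simp_all add: dot_eq[of p "{}"])

lemma heisenberg_carrier:
  "(x, y, z) \<in> carrier (heisenberg p) \<longleftrightarrow>
     x \<in> fin_seqs p \<and> y \<in> fin_seqs p \<and> 0 \<le> z \<and> z < int p"
  by (auto simp: heisenberg_def carrier_Fp)

lemma heisenberg_mult:
  "(x, y, z) \<otimes>\<^bsub>heisenberg p\<^esub> (x', y', z') =
     (seq_add p x x', seq_add p y y', (z + z' + dot p x y') mod int p)"
  by (simp add: heisenberg_def add_Fp mod_simps)

lemma heisenberg_one: "\<one>\<^bsub>heisenberg p\<^esub> = (\<lambda>_. 0, \<lambda>_. 0, 0)"
  by (simp add: heisenberg_def zero_Fp)

lemma seq_add_assoc: "seq_add p (seq_add p x y) z = seq_add p x (seq_add p y z)"
  by (auto simp: seq_add_def add_Fp mod_simps add.assoc)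

lemma seq_add_commute: "seq_add p x y = seq_add p y x"
  by (simp add: seq_add_def add_Fp add.commute)

lemma seq_add_left_cancel:
  assumes "x \<in> fin_seqs p" "y \<in> fin_seqs p" "seq_add p a x = seq_add p a y"
  shows "x = y"
proof
  fix i
  have "(a i + x i) mod int p = (a i + y i) mod int p"
    using assms(3) by (auto simp: seq_add_def add_Fp dest: fun_cong[of _ _ i])
  then have "x i mod int p = y i mod int p"
    by (metis add_diff_cancel_left' mod_diff_left_eq)
  then show "x i = y i"
    using assms(1,2) by (simp add: fin_seqs_iff)
qed

lemma zero_fin_seqs: "p > 1 \<Longrightarrow> (\<lambda>_. 0) \<in> fin_seqs p"
  by (simp add: fin_seqs_iff)

lemma seq_add_zero: "x \<in> fin_seqs p \<Longrightarrow> seq_add p (\<lambda>_. 0) x = x"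
  by (auto simp: seq_add_def add_Fp fin_seqs_iff)

lemma fin_seqs_neg:
  assumes "p > 1" "x \<in> fin_seqs p"
  shows "(\<lambda>i. (- x i) mod int p) \<in> fin_seqs p"
    and "seq_add p (\<lambda>i. (- x i) mod int p) x = (\<lambda>_. 0)"
  using assms by (auto simp: fin_seqs_iff seq_add_def add_Fp mod_simps
      intro: finite_subset[of _ "{i. x i \<noteq> 0}"])

lemma mod_add3: "(a + m mod k + n mod k) mod k = (a + m + n) mod (k :: int)"
proof -
  have "(a + m mod k + n mod k) mod k = ((a + m mod k) mod k + n mod k) mod k"
    by (simp only: mod_add_left_eq)
  also have "\<dots> = ((a + m) mod k + n mod k) mod k"
    by (simp only: mod_add_right_eq)
  finally show ?thesis
    by (simp only: mod_add_eq)
qed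

lemma group_heisenberg:
  assumes "p > 1"
  shows "group (heisenberg p)"
proof (rule groupI)
  fix g h assume "g \<in> carrier (heisenberg p)" "h \<in> carrier (heisenberg p)"
  then show "g \<otimes>\<^bsub>heisenberg p\<^esub> h \<in> carrier (heisenberg p)"
    using assms by (cases g, cases h)
      (auto simp: heisenberg_mult heisenberg_carrier fin_seqs_add)
next
  show "\<one>\<^bsub>heisenberg p\<^esub> \<in> carrier (heisenberg p)"
    using assms by (auto simp: heisenberg_one heisenberg_carrier zero_fin_seqs)
next
  fix g h k
  assume *: "g \<in> carrier (heisenberg p)" "h \<in> carrier (heisenberg p)" "k \<in> carrier (heisenberg p)"
  obtain x y z x' y' z' x'' y'' z'' where
    "g = (x, y, z)" "h = (x', y', z')" "k = (x'', y'', z'')" by (metis prod_cases3)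
  with * show "g \<otimes>\<^bsub>heisenberg p\<^esub> h \<otimes>\<^bsub>heisenberg p\<^esub> k = g \<otimes>\<^bsub>heisenberg p\<^esub> (h \<otimes>\<^bsub>heisenberg p\<^esub> k)"
    using assms mod_add3[of z "z' + z'' + dot p x' y''" "int p" "dot p x y' + dot p x y''"]
      mod_add3[of z'' "z + z' + dot p x y'" "int p" "dot p x y'' + dot p x' y''"]
    unfolding \<open>g = _\<close> \<open>h = _\<close> \<open>k = _\<close> heisenberg_carrier heisenberg_mult
    by (simp only: prod.inject seq_add_assoc dot_add_left dot_add_right)
      (simp only: ac_simps simp_thms)
next
  fix g assume "g \<in> carrier (heisenberg p)"
  then show "\<one>\<^bsub>heisenberg p\<^esub> \<otimes>\<^bsub>heisenberg p\<^esub> g = g"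
    using assms
    by (cases g) (auto simp: heisenberg_one heisenberg_mult heisenberg_carrier seq_add_zero)
next
  fix g assume g: "g \<in> carrier (heisenberg p)"
  obtain x y z where [simp]: "g = (x, y, z)" by (metis prod_cases3)
  define x' where "x' = (\<lambda>i. (- x i) mod int p)"
  define y' where "y' = (\<lambda>i. (- y i) mod int p)"
  have "(x', y', (- z - dot p x' y) mod int p) \<in> carrier (heisenberg p)"
    using g assms fin_seqs_neg[OF assms, of x] fin_seqs_neg[OF assms, of y]
    by (auto simp: heisenberg_carrier x'_def y'_def)
  moreover have "(x', y', (- z - dot p x' y) mod int p) \<otimes>\<^bsub>heisenberg p\<^esub> g = \<one>\<^bsub>heisenberg p\<^esub>"
    using g assms fin_seqs_neg[OF assms, of x] fin_seqs_neg[OF assms, of y]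
    by (auto simp: heisenberg_carrier heisenberg_mult heisenberg_one x'_def y'_def add.assoc mod_add_left_eq)
  ultimately show "\<exists>h\<in>carrier (heisenberg p). h \<otimes>\<^bsub>heisenberg p\<^esub> g = \<one>\<^bsub>heisenberg p\<^esub>"
    by blast
qed

lemma heisenberg_commute_iff:
  "p > 1 \<Longrightarrow> (x, y, z) \<otimes>\<^bsub>heisenberg p\<^esub> (a, b, c) = (a, b, c) \<otimes>\<^bsub>heisenberg p\<^esub> (x, y, z) \<longleftrightarrow>
     (dot p x b - dot p a y) mod int p = 0"
proof -
  have "(z + c + dot p x b) mod int p = (c + z + dot p a y) mod int p \<longleftrightarrow>
      (dot p x b - dot p a y) mod int p = 0"
    unfolding mod_eq_dvd_iff mod_eq_0_iff_dvd by (simp add: algebra_simps)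
  then show ?thesis
    by (simp add: heisenberg_mult seq_add_commute)
qed

lemma unit_fin_seqs:
  assumes "p > 1" "0 \<le> t" "t < int p"
  shows "(\<lambda>j. if j = i then t else 0) \<in> fin_seqs p"
    and "dot p (\<lambda>j. if j = i then t else 0) y = (t * y i) mod int p"
  using assms dot_eq[of p "{i}" "\<lambda>j. if j = i then t else 0" y]
  by (auto simp: fin_seqs_iff intro: finite_subset[of _ "{i}"])

lemma solve_Fp:
  assumes "prime p" "0 < t" "t < int p"
  obtains s where "0 \<le> s" "s < int p" "(s * t) mod int p = d mod int p"
proof -
  have "coprime t (int p)"
    using assms by (metis coprime_commute prime_imp_coprime prime_int_iff prime_nat_int_transfer
        zdvd_not_zless)
  then obtain u where u: "[t * u = 1] (mod int p)"
    using cong_solve_coprime_int by blast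
  have p: "int p > 0" using assms by linarith
  have "((d * u) mod int p * t) mod int p = (d * (t * u)) mod int p"
    by (simp add: mod_simps ac_simps)
  also have "\<dots> = d mod int p"
    using u by (metis cong_def mod_mult_right_eq mult.right_neutral)
  finally show thesis
    using that[of "(d * u) mod int p"] p by simp
qed

lemma solve_symplectic:
  assumes "prime p" "x \<in> fin_seqs p" "y \<in> fin_seqs p" "(x, y) \<noteq> (\<lambda>_. 0, \<lambda>_. 0)"
  obtains a b where "a \<in> fin_seqs p" "b \<in> fin_seqs p"
    "(dot p a y - dot p x b) mod int p = d mod int p"
proof -
  have p: "p > 1" using assms(1) prime_gt_1_nat by blast
  consider i where "y i \<noteq> 0" | i where "x i \<noteq> 0" using assms(4) by fastforce
  then show thesis
  proof cases
    case 1
    then have "0 < y i" "y i < int p" using assms(3) by (auto simp: fin_seqs_iff order.strict_iff_order)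
    then obtain s where s: "0 \<le> s" "s < int p" "(s * y i) mod int p = d mod int p"
      using solve_Fp[OF assms(1)] by blast
    show thesis
      using that[OF unit_fin_seqs(1)[OF p s(1,2), of i] zero_fin_seqs[OF p]] p s
      by (simp add: unit_fin_seqs(2))
  next
    case 2
    then have "0 < x i" "x i < int p" using assms(2) by (auto simp: fin_seqs_iff order.strict_iff_order)
    then obtain s where s: "0 \<le> s" "s < int p" "(s * x i) mod int p = (- d) mod int p"
      using solve_Fp[OF assms(1)] by blast
    have "(- ((s * x i) mod int p)) mod int p = d mod int p"
      using s(3) by (simp add: mod_simps)
    then show thesis
      using that[OF zero_fin_seqs[OF p] unit_fin_seqs(1)[OF p s(1,2), of i]] p s
      by (simp add: dot_commute[of p x] unit_fin_seqs(2))
  qed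
qed

lemma heisenberg_center:
  assumes "prime p"
  shows "center (heisenberg p) = {(\<lambda>_. 0, \<lambda>_. 0, z) | z. 0 \<le> z \<and> z < int p}"
proof -
  have p: "p > 1" using assms prime_gt_1_nat by blast
  have "(x, y) = (\<lambda>_. 0, \<lambda>_. 0)" if "(x, y, z) \<in> center (heisenberg p)" for x y z
  proof (rule ccontr)
    assume "(x, y) \<noteq> (\<lambda>_. 0, \<lambda>_. 0)"
    moreover have xy: "x \<in> fin_seqs p" "y \<in> fin_seqs p"
      using that by (auto simp: center_def heisenberg_carrier)
    ultimately obtain a b where ab: "a \<in> fin_seqs p" "b \<in> fin_seqs p"
      "(dot p a y - dot p x b) mod int p = 1 mod int p"
      using solve_symplectic[OF assms] by blast
    moreover have "(a, b, 0) \<otimes>\<^bsub>heisenberg p\<^esub> (x, y, z) = (x, y, z) \<otimes>\<^bsub>heisenberg p\<^esub> (a, b, 0)"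
      using that ab p by (auto simp: center_def heisenberg_carrier)
    ultimately show False using p by (simp add: heisenberg_commute_iff)
  qed
  moreover have "(\<lambda>_. 0, \<lambda>_. 0, z) \<in> center (heisenberg p)" if "0 \<le> z" "z < int p" for z
    using that p by (auto simp: center_def heisenberg_carrier zero_fin_seqs heisenberg_commute_iff)
  moreover have "0 \<le> z \<and> z < int p" if "(x, y, z) \<in> center (heisenberg p)" for x y z
    using that by (simp add: center_def heisenberg_carrier)
  ultimately have "(x, y, z) \<in> center (heisenberg p) \<longleftrightarrow>
      x = (\<lambda>_. 0) \<and> y = (\<lambda>_. 0) \<and> 0 \<le> z \<and> z < int p" for x y z
    by blast
  then show ?thesis
    by auto
qed

lemma conj_class_iff:
  fixes G (structure)
  assumes "group G" "x \<in> carrier G"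
  shows "w \<in> conj_class G x \<longleftrightarrow>
    w \<in> carrier G \<and> (\<exists>g\<in>carrier G. g \<otimes>\<^bsub>G\<^esub> x = w \<otimes>\<^bsub>G\<^esub> g)"
proof -
  interpret group G by fact
  have "w = g \<otimes> x \<otimes> inv g \<longleftrightarrow> w \<in> carrier G \<and> g \<otimes> x = w \<otimes> g" if "g \<in> carrier G" for g
    using that assms(2) inv_solve_right[of w "g \<otimes> x" g] by auto
  then show ?thesis
    using assms(2) by (auto simp: conj_class_def orbit_def)
qed

definition heis_class :: "nat \<Rightarrow> (nat \<Rightarrow> int) \<Rightarrow> (nat \<Rightarrow> int) \<Rightarrow> heis set" where
  "heis_class p x y = {(x, y, z) | z. z \<in> carrier (Fp p)}"

lemma conj_class_heisenberg:
  assumes "prime p" "(x, y, z) \<in> carrier (heisenberg p)" "(x, y) \<noteq> (\<lambda>_. 0, \<lambda>_. 0)"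
  shows "conj_class (heisenberg p) (x, y, z) = heis_class p x y"
proof (intro Set.set_eqI iffI)
  have p: "p > 1" using assms prime_gt_1_nat by blast
  have xy: "x \<in> fin_seqs p" "y \<in> fin_seqs p" using assms(2) by (auto simp: heisenberg_carrier)
  note iff = conj_class_iff[OF group_heisenberg[OF p] assms(2)]
  fix w assume "w \<in> conj_class (heisenberg p) (x, y, z)"
  then obtain x' y' z' a b c where [simp]: "w = (x', y', z')"
    and *: "(x', y', z') \<in> carrier (heisenberg p)" "(a, b, c) \<in> carrier (heisenberg p)"
      "(a, b, c) \<otimes>\<^bsub>heisenberg p\<^esub> (x, y, z) = (x', y', z') \<otimes>\<^bsub>heisenberg p\<^esub> (a, b, c)"
    unfolding iff Bex_def split_paired_Ex by (cases w) blast
  have "x = x'" "y = y'"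
  proof -
    have "seq_add p a x = seq_add p x' a" "seq_add p b y = seq_add p y' b"
      using *(3) by (simp_all add: heisenberg_mult)
    then have "seq_add p a x = seq_add p a x'" "seq_add p b y = seq_add p b y'"
      using seq_add_commute by metis+
    then show "x = x'" "y = y'"
      using xy *(1) seq_add_left_cancel by (auto simp: heisenberg_carrier)
  qed
  then show "w \<in> heis_class p x y"
    using * by (auto simp: heis_class_def heisenberg_carrier carrier_Fp)
next
  have p: "p > 1" using assms prime_gt_1_nat by blast
  have xy: "x \<in> fin_seqs p" "y \<in> fin_seqs p" using assms(2) by (auto simp: heisenberg_carrier)
  note iff = conj_class_iff[OF group_heisenberg[OF p] assms(2)]
  fix w assume "w \<in> heis_class p x y"
  then obtain z' where w: "w = (x, y, z')" "0 \<le> z'" "z' < int p"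
    by (auto simp: heis_class_def carrier_Fp)
  obtain a b where ab: "a \<in> fin_seqs p" "b \<in> fin_seqs p"
    "(dot p a y - dot p x b) mod int p = (z' - z) mod int p"
    using solve_symplectic[OF assms(1) xy assms(3)] by blast
  have "(0 + z + dot p a y) mod int p = (z' + 0 + dot p x b) mod int p"
    using ab(3) unfolding mod_eq_dvd_iff by (simp add: algebra_simps)
  then have "(a, b, 0) \<otimes>\<^bsub>heisenberg p\<^esub> (x, y, z) = w \<otimes>\<^bsub>heisenberg p\<^esub> (a, b, 0)"
    by (simp add: w(1) heisenberg_mult seq_add_commute)
  moreover have "(a, b, 0) \<in> carrier (heisenberg p)" "w \<in> carrier (heisenberg p)"
    using ab xy p w by (auto simp: heisenberg_carrier)
  ultimately show "w \<in> conj_class (heisenberg p) (x, y, z)"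
    unfolding iff by blast
qed

text \<open>For the Heisenberg group the graph is the expected one: the vertices are the
  classes \<open>C\<^sub>x\<^sub>,\<^sub>y\<close> with \<open>(x, y) \<noteq> (0, 0)\<close>, and adjacency is the vanishing of the
  symplectic form.\<close>

theorem noncentral_classes_heisenberg:
  assumes "prime p"
  shows "noncentral_classes (heisenberg p) =
    {heis_class p x y | x y. x \<in> fin_seqs p \<and> y \<in> fin_seqs p \<and> (x, y) \<noteq> (\<lambda>_. 0, \<lambda>_. 0)}"
proof -
  have "p > 1" using assms prime_gt_1_nat by blast
  then have *: "(x, y, z) \<in> carrier (heisenberg p) - center (heisenberg p) \<longleftrightarrow>
      x \<in> fin_seqs p \<and> y \<in> fin_seqs p \<and> (0 \<le> z \<and> z < int p) \<and> (x, y) \<noteq> (\<lambda>_. 0, \<lambda>_. 0)" for x y z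
    by (auto simp: heisenberg_carrier heisenberg_center[OF assms])
  show ?thesis
  proof (intro Set.set_eqI iffI)
    fix A assume "A \<in> noncentral_classes (heisenberg p)"
    then obtain x y z where A: "A = conj_class (heisenberg p) (x, y, z)"
      "(x, y, z) \<in> carrier (heisenberg p) - center (heisenberg p)"
      unfolding noncentral_classes_def by (auto elim!: imageE)
    then have "A = heis_class p x y"
      using conj_class_heisenberg[OF assms, of x y z] * by blast
    with A(2) show "A \<in> {heis_class p x y | x y.
        x \<in> fin_seqs p \<and> y \<in> fin_seqs p \<and> (x, y) \<noteq> (\<lambda>_. 0, \<lambda>_. 0)}"
      unfolding * by blast
  next
    fix A assume "A \<in> {heis_class p x y | x y.
        x \<in> fin_seqs p \<and> y \<in> fin_seqs p \<and> (x, y) \<noteq> (\<lambda>_. 0, \<lambda>_. 0)}"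
    then obtain x y where A: "A = heis_class p x y"
      "x \<in> fin_seqs p" "y \<in> fin_seqs p" "(x, y) \<noteq> (\<lambda>_. 0, \<lambda>_. 0)" by blast
    then have "(x, y, 0) \<in> carrier (heisenberg p) - center (heisenberg p)"
      unfolding * using \<open>p > 1\<close> by simp
    with A show "A \<in> noncentral_classes (heisenberg p)"
      unfolding noncentral_classes_def using conj_class_heisenberg[OF assms, of x y 0] by blast
  qed
qed

theorem commuting_classes_heisenberg:
  assumes "prime p" "x \<in> fin_seqs p" "b \<in> fin_seqs p" "a \<in> fin_seqs p" "y \<in> fin_seqs p"
  shows "commuting_classes (heisenberg p) (heis_class p x y) (heis_class p a b) \<longleftrightarrow>
    dot p x b \<ominus>\<^bsub>Fp p\<^esub> dot p a y = \<zero>\<^bsub>Fp p\<^esub>"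
proof -
  have p: "p > 1" using assms prime_gt_1_nat by blast
  interpret residues "int p" "Fp p" using p by unfold_locales auto
  have "dot p x b \<ominus>\<^bsub>Fp p\<^esub> dot p a y = (dot p x b - dot p a y) mod int p"
    by (simp add: a_minus_def res_neg_eq add_Fp mod_simps)
  moreover have "0 \<in> carrier (Fp p)"
    using p by (simp add: carrier_Fp)
  moreover have "commuting_classes (heisenberg p) (heis_class p x y) (heis_class p a b) \<longleftrightarrow>
      (\<forall>z\<in>carrier (Fp p). \<forall>c\<in>carrier (Fp p). (dot p x b - dot p a y) mod int p = 0)"
    by (fastforce simp: commuting_classes_def heis_class_def heisenberg_commute_iff[OF p])
  ultimately show ?thesis
    unfolding zero_Fp by auto
qed

text \<open>The Rado graph exists: join \<open>m\<close> and \<open>n\<close> if bit \<open>m\<close> of \<open>n\<close> or bit \<open>n\<close> of \<open>m\<close> is set.\<close>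

theorem rado_graph_exists:
  "rado_graph (UNIV :: nat set) (\<lambda>m n. m \<noteq> n \<and> (m \<in> set_decode n \<or> n \<in> set_decode m))"
proof -
  have less: "m < n" if "m \<in> set_decode n" for m n
  proof -
    have "2 ^ m \<le> n" using that by (auto simp: set_decode_def not_less intro: ccontr)
    then show ?thesis using less_exp[of m] by linarith
  qed
  have "\<exists>v\<in>UNIV - (U \<union> W). (\<forall>u\<in>U. v \<noteq> u \<and> (v \<in> set_decode u \<or> u \<in> set_decode v)) \<and>
      (\<forall>w\<in>W. \<not> (v \<noteq> w \<and> (v \<in> set_decode w \<or> w \<in> set_decode v)))"
    if fin: "finite U" "finite W" "U \<inter> W = {}" for U W :: "nat set"
  proof -
    define N where "N = Suc (Max (insert 0 (U \<union> W)))"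
    have N: "u < N" if "u \<in> U \<union> W" for u
      using that fin by (simp add: N_def less_Suc_eq_le)
    define v where "v = set_encode (insert N U)"
    have v: "set_decode v = insert N U"
      using fin by (simp add: v_def)
    have "N < v" using less[of N v] v by simp
    then have "u < v" if "u \<in> U \<union> W" for u using N[OF that] by simp
    moreover have "w \<notin> insert N U" if "w \<in> W" for w
      using N[of w] that fin(3) by auto
    ultimately show ?thesis
      using less by (intro bexI[of _ v]) (auto simp: v dest!: less_asym[of _ v] less)
  qed
  then show ?thesis
    unfolding rado_graph_def simple_graph_def by auto
qed

end

theory Submission
  imports Defs
begin

text \<open>The Rado graph is countable and its adjacency is symmetric, and every such graph has an
  induced copy in the commuting graph. Enumerate the vertices as \<open>v\<^sub>0, v\<^sub>1, \<dots>\<close>, and send \<open>v\<^sub>n\<close> to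
  the class of \<open>(e\<^sub>n, y\<^sub>n)\<close>, where \<open>e\<^sub>n\<close> is the \<open>n\<close>-th unit sequence and \<open>y\<^sub>n\<close> is the indicator of
  those \<open>m < n\<close> for which \<open>v\<^sub>m\<close> is \<^emph>\<open>not\<close> adjacent to \<open>v\<^sub>n\<close>. The first components make the map
  injective and keep it away from the centre. Since \<open>e\<^sub>n\<close> reads off the \<open>n\<close>-th entry, the
  symplectic form of the images of \<open>v\<^sub>m\<close> and \<open>v\<^sub>n\<close> with \<open>m < n\<close> is \<open>y\<^sub>n(m) - y\<^sub>m(n)\<close>. Here
  \<open>y\<^sub>m(n) = 0\<close> because \<open>n\<close> is not below \<open>m\<close>, so the form is \<open>y\<^sub>n(m)\<close>, which vanishes exactly when
  the two vertices are adjacent. Each \<open>y\<^sub>n\<close> is finitely supported because it looks only at the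
  predecessors of \<open>n\<close>; this is where the countability of the graph and the infinite rank of the
  group are used.\<close>

lemma commuting_classes_heisenberg_iff:
  assumes "prime p" "x \<in> fin_seqs p" "y \<in> fin_seqs p" "a \<in> fin_seqs p" "b \<in> fin_seqs p"
  shows "commuting_classes (heisenberg p) (heis_class p x y) (heis_class p a b) \<longleftrightarrow>
    dot p x b = dot p a y"
proof -
  have p: "p > 1" using assms(1) prime_gt_1_nat by blast
  interpret residues "int p" "Fp p" using p by unfold_locales auto
  have "dot p x b \<in> carrier (Fp p)" "dot p a y \<in> carrier (Fp p)"
    using dot_range[OF p] assms by (auto simp: carrier_Fp)
  then show ?thesis
    using commuting_classes_heisenberg[OF assms(1,2,5,4,3)] by simp
qed

text \<open>Each non-adjacency is recorded once, at the vertex with the larger index, so \<open>adj\<close> is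
  consulted in only one of its two orders; symmetry makes this enough.\<close>

theorem countable_graph_induced_copy:
  fixes V :: "'v set"
  assumes "prime p" "countable V"
    and sym: "\<And>u v. u \<in> V \<Longrightarrow> v \<in> V \<Longrightarrow> adj u v \<Longrightarrow> adj v u"
  shows "induced_copy V adj
           (noncentral_classes (heisenberg p)) (commuting_classes (heisenberg p))"
proof -
  have p: "p > 1" using assms(1) prime_gt_1_nat by blast
  obtain g :: "'v \<Rightarrow> nat" where g: "inj_on g V"
    using assms(2) by (auto simp: countable_def)
  define e :: "'v \<Rightarrow> nat \<Rightarrow> int" where "e v = (\<lambda>i. if i = g v then 1 else 0)" for v
  define y :: "'v \<Rightarrow> nat \<Rightarrow> int" where
    "y v = (\<lambda>i. if i < g v \<and> (\<exists>u\<in>V. g u = i \<and> \<not> adj u v) then 1 else 0)" for v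
  define f where "f v = heis_class p (e v) (y v)" for v
  have e: "e v \<in> fin_seqs p" for v
    using unit_fin_seqs(1)[of p 1 "g v"] p by (simp add: e_def)
  have y: "y v \<in> fin_seqs p" for v
    using p by (auto simp: y_def fin_seqs_iff intro: finite_subset[of _ "{..<g v}"])
  have dot: "dot p (e u) (y v) = y v (g u)" for u v
    using unit_fin_seqs(2)[of p 1 "g u" "y v"] p by (simp add: e_def y_def)
  have y_at: "y v (g u) = (if g u < g v \<and> \<not> adj u v then 1 else 0)" if "u \<in> V" for u v
    using that g by (auto simp: y_def inj_on_def)
  have "inj_on f V"
  proof (rule inj_onI)
    fix u v assume uv: "u \<in> V" "v \<in> V" "f u = f v"
    have "(e u, y u, 0) \<in> f u"
      using p by (simp add: f_def heis_class_def carrier_Fp)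
    then have "e u = e v"
      unfolding uv(3) by (simp add: f_def heis_class_def)
    then have "e u (g u) = e v (g u)"
      by simp
    then have "g u = g v"
      by (simp add: e_def split: if_splits)
    then show "u = v"
      using g uv by (simp add: inj_on_def)
  qed
  moreover have "f ` V \<subseteq> noncentral_classes (heisenberg p)"
  proof (rule image_subsetI)
    fix v
    have "e v (g v) \<noteq> 0"
      by (simp add: e_def)
    then have "(e v, y v) \<noteq> (\<lambda>_. 0, \<lambda>_. 0)"
      by auto
    then have "\<exists>a b. f v = heis_class p a b \<and> a \<in> fin_seqs p \<and> b \<in> fin_seqs p
        \<and> (a, b) \<noteq> (\<lambda>_. 0, \<lambda>_. 0)"
      by (intro exI[of _ "e v"] exI[of _ "y v"] conjI e y) (simp_all add: f_def)
    then show "f v \<in> noncentral_classes (heisenberg p)"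
      unfolding noncentral_classes_heisenberg[OF assms(1)] mem_Collect_eq .
  qed
  moreover have "adj u v \<longleftrightarrow> commuting_classes (heisenberg p) (f u) (f v)"
    if uv: "u \<in> V" "v \<in> V" "u \<noteq> v" for u v
  proof -
    have "commuting_classes (heisenberg p) (f u) (f v) \<longleftrightarrow> y v (g u) = y u (g v)"
      by (simp add: f_def commuting_classes_heisenberg_iff[OF assms(1) e y e y] dot)
    moreover have "g u \<noteq> g v"
      using uv g by (auto simp: inj_on_def)
    moreover have "adj u v \<longleftrightarrow> adj v u"
      using sym uv by blast
    ultimately show ?thesis
      using uv(1,2) by (cases "g u < g v") (simp_all add: y_at)
  qed
  ultimately show ?thesis
    unfolding induced_copy_def by blast
qed

theorem corollary4p8:
  fixes p :: nat and V :: "'v set" and adj :: "'v \<Rightarrow> 'v \<Rightarrow> bool"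
  assumes "prime p" and "odd p"
    and "rado_graph V adj"
  shows "induced_copy V adj
           (noncentral_classes (heisenberg p)) (commuting_classes (heisenberg p))"
proof (rule countable_graph_induced_copy[OF assms(1)])
  show "countable V"
    using assms(3) by (simp add: rado_graph_def)
  show "adj v u" if "u \<in> V" "v \<in> V" "adj u v" for u v
    using assms(3) that by (simp add: rado_graph_def simple_graph_def)
qed

end
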